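(* Let $\mathcal{K}$ be a reproducing kernel Krein space on a set $\mathcal{X}\subseteq\mathbb{C}^n$, with Hermitian form $[\cdot,\cdot]$ and nonsingular kernel $K=K_+-K_-$, and let $\mathcal{A}=\{(x_1,\lambda_1),(x_2,\lambda_2),\dots,(x_N,\lambda_N)\}$ be interpolation data with $x_j\in\mathcal{X}$ and $\lambda_j\in\mathbb{C}$. Let $\mathcal{F}$ denote the affine space of functions $f\in\mathcal{K}$ which interpolate $\mathcal{A}$, i.e. $f(x_j)=\lambda_j$ for $j=1,\dots,N$. Let $\mathcal{H}_{\mathcal{A}}:=\mathrm{span}\{k_{x_j}\mid j=1,2,\dots,N\}$, where $k_y(\cdot)=K(\cdot,y)$. If $\mathcal{F}$ does not contain the zero function, and $K_+\neq c\pm K_-$ for any $c\in\mathbb{R}$, then $\mathcal{F}$ is orthogonal in the Krein sense to $\mathcal{H}_{\mathcal{A}}$, that is, $[f-g,h]=0$ for all $f,g\in\mathcal{F}$ and $h\in\mathcal{H}_{\mathcal{A}}$. Moreover, there is a unique function $h\in\mathcal{H}_{\mathcal{A}}\cap\mathcal{F}$.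
   Context: A Krein space is a complex vector space $\mathcal{K}$ with a Hermitian form $[\cdot,\cdot]$ admitting a decomposition $\mathcal{K}=\mathcal{K}_+\oplus\mathcal{K}_-$, with $[k_+,k_-]=0$ for $k_\pm\in\mathcal{K}_\pm$, such that $(\mathcal{K}_+,[\cdot,\cdot])$ and $(\mathcal{K}_-,-[\cdot,\cdot])$ are Hilbert spaces. Elements $f,g$ are orthogonal in the Krein sense if $[f,g]=0$. A reproducing kernel Krein space on $\mathcal{X}$ is a Krein space of functions on $\mathcal{X}$ with a kernel $K(x,y)=k_y(x)$ such that $k_z\in\mathcal{K}$ and $f(z)=[f,k_z]$ for all $z\in\mathcal{X}$, $f\in\mathcal{K}$. In the decomposition $K=K_+-K_-$, both $K_+$ and $K_-$ are kernel functions (all of their finite Gram matrices are nonnegative semidefinite). The kernel $K$ being nonsingular means that the matrix with $(i,j)$ entry $K(x_i,x_j)$, $1\le i,j\le N$, is invertible. *)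

theory Defs
  imports "HOL-Analysis.Analysis" "HOL-Library.Function_Algebras"
begin

locale complex_vector_space = vector_space scale
  for scale :: "complex \<Rightarrow> 'v::ab_group_add \<Rightarrow> 'v"
begin

text \<open>Forms are total functions on the ambient type, but only their values on the given
  subspace matter. They are linear in the first and conjugate-linear in the second argument.\<close>

definition hermitian_form_on :: "'v set \<Rightarrow> ('v \<Rightarrow> 'v \<Rightarrow> complex) \<Rightarrow> bool" where
  "hermitian_form_on V B \<longleftrightarrow>
     (\<forall>u\<in>V. \<forall>v\<in>V. \<forall>w\<in>V. B (u + v) w = B u w + B v w) \<and>
     (\<forall>a. \<forall>u\<in>V. \<forall>v\<in>V. B (scale a u) v = a * B u v) \<and>
     (\<forall>u\<in>V. \<forall>v\<in>V. B v u = cnj (B u v))"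

definition form_norm :: "('v \<Rightarrow> 'v \<Rightarrow> complex) \<Rightarrow> 'v \<Rightarrow> real" where
  "form_norm B u = sqrt (Re (B u u))"

definition complete_form_on :: "'v set \<Rightarrow> ('v \<Rightarrow> 'v \<Rightarrow> complex) \<Rightarrow> bool" where
  "complete_form_on V B \<longleftrightarrow>
     (\<forall>s :: nat \<Rightarrow> 'v.
        (\<forall>n. s n \<in> V) \<and>
        (\<forall>e>0. \<exists>M. \<forall>m\<ge>M. \<forall>n\<ge>M. form_norm B (s m - s n) < e) \<longrightarrow>
        (\<exists>l\<in>V. (\<lambda>n. form_norm B (s n - l)) \<longlonglongrightarrow> 0))"

definition hilbert_space_on :: "'v set \<Rightarrow> ('v \<Rightarrow> 'v \<Rightarrow> complex) \<Rightarrow> bool" where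
  "hilbert_space_on V B \<longleftrightarrow>
     subspace V \<and> hermitian_form_on V B \<and>
     (\<forall>u\<in>V. u \<noteq> 0 \<longrightarrow> 0 < Re (B u u)) \<and>
     complete_form_on V B"

definition krein_space_on :: "'v set \<Rightarrow> ('v \<Rightarrow> 'v \<Rightarrow> complex) \<Rightarrow> bool" where
  "krein_space_on V B \<longleftrightarrow>
     subspace V \<and> hermitian_form_on V B \<and>
     (\<exists>Vp Vm. V = {u + v |u v. u \<in> Vp \<and> v \<in> Vm} \<and> Vp \<inter> Vm = {0} \<and>
        (\<forall>u\<in>Vp. \<forall>v\<in>Vm. B u v = 0) \<and>
        hilbert_space_on Vp B \<and>
        hilbert_space_on Vm (\<lambda>u v. - B u v))"

end

definition scale_fun :: "complex \<Rightarrow> ('a \<Rightarrow> complex) \<Rightarrow> 'a \<Rightarrow> complex" where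
  "scale_fun a f = (\<lambda>x. a * f x)"

interpretation fun_space: complex_vector_space scale_fun
  by unfold_locales (auto simp: scale_fun_def fun_eq_iff algebra_simps)

text \<open>A function on \<open>X\<close> is represented by its extension by zero to the ambient type, so
  that functions on \<open>X\<close> form a genuine vector space with the pointwise operations.
  In particular, for \<open>z \<in> X\<close> the section \<open>\<lambda>x. K x z\<close> vanishes outside \<open>X\<close>.\<close>

definition reproducing_kernel_krein_space ::
    "'a set \<Rightarrow> ('a \<Rightarrow> complex) set \<Rightarrow>
     (('a \<Rightarrow> complex) \<Rightarrow> ('a \<Rightarrow> complex) \<Rightarrow> complex) \<Rightarrow>
     ('a \<Rightarrow> 'a \<Rightarrow> complex) \<Rightarrow> bool" where
  "reproducing_kernel_krein_space X V B K \<longleftrightarrow>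
     (\<forall>f\<in>V. \<forall>z. z \<notin> X \<longrightarrow> f z = 0) \<and>
     fun_space.krein_space_on V B \<and>
     (\<forall>z\<in>X. (\<lambda>x. K x z) \<in> V) \<and>
     (\<forall>z\<in>X. \<forall>f\<in>V. f z = B f (\<lambda>x. K x z))"

definition kernel_function_on :: "'a set \<Rightarrow> ('a \<Rightarrow> 'a \<Rightarrow> complex) \<Rightarrow> bool" where
  "kernel_function_on X K \<longleftrightarrow>
     (\<forall>n. \<forall>x :: nat \<Rightarrow> 'a. \<forall>a :: nat \<Rightarrow> complex. (\<forall>i<n. x i \<in> X) \<longrightarrow>
        (\<Sum>i<n. \<Sum>j<n. cnj (a i) * K (x i) (x j) * a j) \<in> \<real>\<^sub>\<ge>\<^sub>0)"

definition nonsingular_at :: "('a \<Rightarrow> 'a \<Rightarrow> complex) \<Rightarrow> ('m::finite \<Rightarrow> 'a) \<Rightarrow> bool" where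
  "nonsingular_at K x \<longleftrightarrow> invertible ((\<chi> i j. K (x i) (x j)) :: complex ^ 'm ^ 'm)"

definition interpolants ::
    "('a \<Rightarrow> complex) set \<Rightarrow> ('m \<Rightarrow> 'a) \<Rightarrow> ('m \<Rightarrow> complex) \<Rightarrow> ('a \<Rightarrow> complex) set" where
  "interpolants V x l = {f \<in> V. \<forall>j. f (x j) = l j}"

definition kernel_span :: "('a \<Rightarrow> 'a \<Rightarrow> complex) \<Rightarrow> ('m \<Rightarrow> 'a) \<Rightarrow> ('a \<Rightarrow> complex) set" where
  "kernel_span K x = fun_space.span (range (\<lambda>j z. K z (x j)))"

end

theory Submission
  imports Defs
begin

text \<open>
  The reproducing property turns both claims into linear algebra at the nodes. A difference of
  two interpolants vanishes at every node \<open>x j\<close>, and the value of \<open>f - g\<close> at \<open>x j\<close> is its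
  product with the kernel section at \<open>x j\<close>; since the vectors orthogonal to a given one form a
  subspace, \<open>f - g\<close> is orthogonal to everything spanned by these sections
  (\<open>subspace_orthogonal\<close>). On the other hand an element \<open>\<Sum>j. a j * K z (x j)\<close> of the span
  (\<open>kernel_span_eq\<close>) takes at the nodes the values of the Gram matrix applied to \<open>a\<close>, so
  interpolating within the span is a linear system with an invertible matrix and therefore has
  exactly one solution.
\<close>

context complex_vector_space
begin

text \<open>The orthogonality is in the second argument, where the form is only conjugate-linear;
  Hermitian symmetry moves the computation to the first argument.\<close>

lemma subspace_orthogonal:
  assumes V: "subspace V" and B: "hermitian_form_on V B" and d: "d \<in> V"
  shows "subspace {h \<in> V. B d h = 0}"
proof -
  have swap: "B d h = cnj (B h d)" if "h \<in> V" for h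
    using B d that unfolding hermitian_form_on_def by blast
  have scl: "B (scale a h) d = a * B h d" if "h \<in> V" for a h
    using B d that unfolding hermitian_form_on_def by blast
  have add: "B (u + v) d = B u d + B v d" if "u \<in> V" "v \<in> V" for u v
    using B d that unfolding hermitian_form_on_def by blast
  have zero: "B 0 d = 0"
    using scl[OF subspace_0[OF V], of 0] by simp
  show ?thesis
    unfolding subspace_def
    using subspace_0[OF V] subspace_add[OF V] subspace_scale[OF V] zero
    by (auto simp: swap scl add)
qed

end

text \<open>Coefficients are indexed by the nodes, not by the set of sections, so that they can be fed
  to the Gram matrix; the description holds even when several nodes give the same section.\<close>

lemma kernel_span_eq:
  fixes x :: "'m::finite \<Rightarrow> 'a"
  shows "kernel_span K x = range (\<lambda>(a :: complex ^ 'm) z. \<Sum>j\<in>UNIV. K z (x j) * a $ j)"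
    (is "_ = ?R")
proof
  have "fun_space.subspace ?R"
    unfolding fun_space.subspace_def
  proof (intro conjI ballI allI)
    show "0 \<in> ?R"
      by (rule range_eqI[where x = 0]) (simp add: fun_eq_iff)
  next
    fix f g assume "f \<in> ?R" "g \<in> ?R"
    then obtain a b :: "complex ^ 'm"
      where f: "f = (\<lambda>z. \<Sum>j\<in>UNIV. K z (x j) * a $ j)"
        and g: "g = (\<lambda>z. \<Sum>j\<in>UNIV. K z (x j) * b $ j)"
      by (elim rangeE)
    show "f + g \<in> ?R"
      by (rule range_eqI[where x = "a + b"])
        (simp add: f g fun_eq_iff distrib_left sum.distrib)
  next
    fix c f assume "f \<in> ?R"
    then obtain a :: "complex ^ 'm" where f: "f = (\<lambda>z. \<Sum>j\<in>UNIV. K z (x j) * a $ j)"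
      by (elim rangeE)
    show "scale_fun c f \<in> ?R"
      by (rule range_eqI[where x = "c *s a"])
        (simp add: f fun_eq_iff scale_fun_def sum_distrib_left mult.left_commute)
  qed
  moreover have "(\<lambda>z. K z (x i)) \<in> ?R" for i
    by (rule range_eqI[where x = "axis i 1"])
      (simp add: fun_eq_iff axis_def if_distrib[where f = "\<lambda>t. _ * t"] cong: if_cong)
  ultimately show "kernel_span K x \<subseteq> ?R"
    unfolding kernel_span_def by (intro fun_space.span_minimal) auto
next
  show "?R \<subseteq> kernel_span K x"
  proof clarify
    fix a :: "complex ^ 'm"
    have "(\<Sum>j\<in>S. f j) z = (\<Sum>j\<in>S. f j z)" if "finite S"
      for S :: "'m set" and f :: "'m \<Rightarrow> 'a \<Rightarrow> complex" and z
      using that by induction auto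
    then have "(\<lambda>z. \<Sum>j\<in>UNIV. K z (x j) * a $ j) =
        (\<Sum>j\<in>UNIV. scale_fun (a $ j) (\<lambda>z. K z (x j)))"
      by (simp add: fun_eq_iff scale_fun_def mult.commute)
    also have "\<dots> \<in> kernel_span K x"
      unfolding kernel_span_def
      by (intro fun_space.span_sum fun_space.span_scale fun_space.span_base rangeI)
    finally show "(\<lambda>z. \<Sum>j\<in>UNIV. K z (x j) * a $ j) \<in> kernel_span K x" .
  qed
qed

theorem theorem4p2p2:
  fixes X :: "(complex ^ 'n) set"
    and V :: "(complex ^ 'n \<Rightarrow> complex) set"
    and B :: "(complex ^ 'n \<Rightarrow> complex) \<Rightarrow> (complex ^ 'n \<Rightarrow> complex) \<Rightarrow> complex"
    and K Kp Km :: "complex ^ 'n \<Rightarrow> complex ^ 'n \<Rightarrow> complex"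
    and x :: "'m::finite \<Rightarrow> complex ^ 'n"
    and l :: "'m \<Rightarrow> complex"
  assumes "reproducing_kernel_krein_space X V B K"
    and "kernel_function_on X Kp"
    and "kernel_function_on X Km"
    and "\<forall>z\<in>X. \<forall>w\<in>X. K z w = Kp z w - Km z w"
    and "\<forall>j. x j \<in> X"
    and "nonsingular_at K x"
    and "0 \<notin> interpolants V x l"
    and "\<forall>c::real. \<not> (\<forall>z\<in>X. \<forall>w\<in>X. Kp z w = of_real c + Km z w)"
    and "\<forall>c::real. \<not> (\<forall>z\<in>X. \<forall>w\<in>X. Kp z w = of_real c - Km z w)"
  shows "(\<forall>f\<in>interpolants V x l. \<forall>g\<in>interpolants V x l. \<forall>h\<in>kernel_span K x.
            B (f - g) h = 0) \<and>
         (\<exists>!h. h \<in> kernel_span K x \<inter> interpolants V x l)"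
proof -
  let ?A = "(\<chi> i j. K (x i) (x j)) :: complex ^ 'm ^ 'm"
  let ?h = "\<lambda>(a :: complex ^ 'm) z. \<Sum>j\<in>UNIV. K z (x j) * a $ j"
  have V: "fun_space.subspace V" and B: "fun_space.hermitian_form_on V B"
    using assms(1) by (auto simp: reproducing_kernel_krein_space_def fun_space.krein_space_on_def)
  have sections: "(\<lambda>z. K z (x j)) \<in> V" for j
    using assms(1,5) by (simp add: reproducing_kernel_krein_space_def)
  have reproducing: "B f (\<lambda>z. K z (x j)) = f (x j)" if "f \<in> V" for f j
    using assms(1,5) that by (simp add: reproducing_kernel_krein_space_def)
  have orthogonal: "B (f - g) h = 0"
    if f: "f \<in> interpolants V x l" and g: "g \<in> interpolants V x l" and h: "h \<in> kernel_span K x"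
    for f g h
  proof -
    have d: "f - g \<in> V"
      using f g fun_space.subspace_diff[OF V] by (simp add: interpolants_def)
    have "(f - g) (x j) = 0" for j
      using f g by (simp add: interpolants_def)
    then have "range (\<lambda>j z. K z (x j)) \<subseteq> {h \<in> V. B (f - g) h = 0}"
      using sections reproducing[OF d] by auto
    then have "kernel_span K x \<subseteq> {h \<in> V. B (f - g) h = 0}"
      unfolding kernel_span_def
      by (intro fun_space.span_minimal fun_space.subspace_orthogonal V B d)
    then show ?thesis
      using h by blast
  qed
  have span_V: "kernel_span K x \<subseteq> V"
    unfolding kernel_span_def using sections by (intro fun_space.span_minimal V) auto
  have interpolates: "?h a \<in> interpolants V x l \<longleftrightarrow> ?A *v a = vec_lambda l" for a
    using span_V
    by (auto simp: interpolants_def kernel_span_eq vec_eq_iff matrix_vector_mult_def)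
  obtain A' where A': "?A ** A' = mat 1" "A' ** ?A = mat 1"
    using assms(6) unfolding nonsingular_at_def invertible_def by blast
  have solution: "?A *v a = vec_lambda l \<longleftrightarrow> a = A' *v vec_lambda l" for a
    using A' by (metis matrix_vector_mul_assoc matrix_vector_mul_lid)
  have "\<exists>!h. h \<in> kernel_span K x \<inter> interpolants V x l"
  proof (rule ex1I)
    show "?h (A' *v vec_lambda l) \<in> kernel_span K x \<inter> interpolants V x l"
      using interpolates solution by (auto simp: kernel_span_eq)
  next
    fix h assume "h \<in> kernel_span K x \<inter> interpolants V x l"
    then show "h = ?h (A' *v vec_lambda l)"
      using interpolates solution by (auto simp: kernel_span_eq)
  qed
  then show ?thesis
    using orthogonal by blast
qed

end
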